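(* Let $m\in L^1(\Omega,\mu)$. Let $F$ and $G$ be Bessel mappings for $\mathcal{H}$ with respect to $(\Omega,\mu)$ and let $G$ be norm bounded. Let $F^{(n)}$, $n\in\mathbb{N}$, be a sequence of Bessel mappings such that $F^{(n)}(\omega)\to F(\omega)$ in a uniform strong sense, i.e. for every $\epsilon>0$ there is $N$ such that $\|F^{(n)}(\omega)-F(\omega)\|\le\epsilon$ for all $n\ge N$ and all $\omega\in\Omega$. Then $\mathbf{M}_{m,F^{(n)},G}$ converges to $\mathbf{M}_{m,F,G}$ in operator norm.
   Context: $\mathcal{H}$ is a complex Hilbert space with inner product linear in the first and conjugate linear in the second variable, and $(\Omega,\mu)$ is a measure space with positive measure $\mu$. A mapping $F:\Omega\to\mathcal{H}$ is a Bessel mapping with respect to $(\Omega,\mu)$ with Bessel bound $B_F$ if $\omega\mapsto\langle f,F(\omega)\rangle$ is measurable for every $f\in\mathcal{H}$ and $\int_\Omega|\langle f,F(\omega)\rangle|^2\,d\mu(\omega)\le B_F\|f\|^2$ for all $f\in\mathcal{H}$. A Bessel mapping $G$ is norm bounded if there is a constant $L_G$ with $\|G(\omega)\|\le L_G$ for almost every $\omega\in\Omega$. For Bessel mappings $F,G$ and a measurable function $m:\Omega\to\mathbb{C}$ (the symbol), the continuous Bessel multiplier $\mathbf{M}_{m,F,G}:\mathcal{H}\to\mathcal{H}$ is the operator weakly defined by $\langle\mathbf{M}_{m,F,G}f,g\rangle=\int_\Omega m(\omega)\langle f,F(\omega)\rangle\langle G(\omega),g\rangle\,d\mu(\omega)$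 for all $f,g\in\mathcal{H}$.
   Formalization: As m is only in L^1 and F, F^(n) need not be norm bounded, the multipliers may fail to exist on all of H; each is taken on the set of f where its weak integrals exist, and convergence means these sets eventually agree and the operator norm of the difference there tends to 0. *)

theory Defs
  imports "HOL-Analysis.Analysis"
begin

text \<open>Complex Hilbert spaces; the inner product is linear in the first and conjugate linear in
  the second argument.\<close>

class complex_hilbert_space = banach +
  fixes scaleC :: "complex \<Rightarrow> 'a \<Rightarrow> 'a"  (infixr "*\<^sub>C" 75)
    and cinner :: "'a \<Rightarrow> 'a \<Rightarrow> complex"
  assumes scaleC_add_right: "c *\<^sub>C (x + y) = c *\<^sub>C x + c *\<^sub>C y"
    and scaleC_add_left: "(c + d) *\<^sub>C x = c *\<^sub>C x + d *\<^sub>C x"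
    and scaleC_scaleC: "c *\<^sub>C d *\<^sub>C x = (c * d) *\<^sub>C x"
    and scaleR_scaleC: "r *\<^sub>R x = complex_of_real r *\<^sub>C x"
    and cinner_commute: "cinner x y = cnj (cinner y x)"
    and cinner_add_left: "cinner (x + y) z = cinner x z + cinner y z"
    and cinner_scaleC_left: "cinner (c *\<^sub>C x) y = c * cinner x y"
    and cinner_self_nonneg: "0 \<le> Re (cinner x x)"
    and norm_eq_sqrt_cinner: "norm x = sqrt (Re (cinner x x))"

definition bessel_mapping :: "'w measure \<Rightarrow> ('w \<Rightarrow> 'a::complex_hilbert_space) \<Rightarrow> bool" where
  "bessel_mapping M F \<longleftrightarrow>
     (\<forall>f. (\<lambda>w. cinner f (F w)) \<in> borel_measurable M) \<and>
     (\<exists>B\<ge>0. \<forall>f. (\<integral>\<^sup>+ w. ennreal ((cmod (cinner f (F w)))\<^sup>2) \<partial>M) \<le> ennreal (B * (norm f)\<^sup>2))"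

definition norm_bounded_mapping :: "'w measure \<Rightarrow> ('w \<Rightarrow> 'a::complex_hilbert_space) \<Rightarrow> bool" where
  "norm_bounded_mapping M G \<longleftrightarrow> (\<exists>L. AE w in M. norm (G w) \<le> L)"

definition weak_multiplier_value ::
  "'w measure \<Rightarrow> ('w \<Rightarrow> complex) \<Rightarrow> ('w \<Rightarrow> 'a::complex_hilbert_space) \<Rightarrow> ('w \<Rightarrow> 'a) \<Rightarrow> 'a \<Rightarrow> 'a \<Rightarrow> bool"
where
  "weak_multiplier_value M m F G f v \<longleftrightarrow>
     (\<forall>g. integrable M (\<lambda>w. m w * cinner f (F w) * cinner (G w) g) \<and>
          cinner v g = (\<integral>w. m w * cinner f (F w) * cinner (G w) g \<partial>M))"

text \<open>For an integrable symbol and unbounded \<open>F\<close> the weak integrals need not converge: on the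
  unit interval with scalar field \<open>\<complex>\<close>, take \<open>m(x) = x powr (-3/4)\<close>, \<open>F(x) = x powr (-1/4)\<close> and
  \<open>G = 1\<close>. The multiplier is therefore a partial operator, defined at exactly those \<open>f\<close> for
  which the weak integrals converge for all \<open>g\<close> and are represented by a vector.\<close>

definition bessel_multiplier ::
  "'w measure \<Rightarrow> ('w \<Rightarrow> complex) \<Rightarrow> ('w \<Rightarrow> 'a::complex_hilbert_space) \<Rightarrow> ('w \<Rightarrow> 'a) \<Rightarrow> 'a \<rightharpoonup> 'a"
where
  "bessel_multiplier M m F G =
     (\<lambda>f. if \<exists>v. weak_multiplier_value M m F G f v
          then Some (THE v. weak_multiplier_value M m F G f v) else None)"

text \<open>Operator norm of the difference of two partial operators, on the common domain. It takes
  the value \<open>\<infinity>\<close> exactly if the difference is unbounded.\<close>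

definition operator_dist ::
  "('a::real_normed_vector \<rightharpoonup> 'b::real_normed_vector) \<Rightarrow> ('a \<rightharpoonup> 'b) \<Rightarrow> ennreal" where
  "operator_dist S T =
     (SUP f\<in>{f \<in> dom S \<inter> dom T. norm f \<le> 1}. ennreal (norm (the (S f) - the (T f))))"

definition converges_in_operator_norm ::
  "(nat \<Rightarrow> 'a::real_normed_vector \<rightharpoonup> 'b::real_normed_vector) \<Rightarrow> ('a \<rightharpoonup> 'b) \<Rightarrow> bool" where
  "converges_in_operator_norm S T \<longleftrightarrow>
     (\<forall>\<^sub>F n in sequentially. dom (S n) = dom T) \<and>
     (\<lambda>n. operator_dist (S n) T) \<longlonglongrightarrow> 0"

text \<open>The next facts relate these notions, for everywhere defined operators, to the weak
  definition and to the operator norm \<^const>\<open>onorm\<close>.\<close>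

lemma cinner_eqI:
  fixes u v :: "'a::complex_hilbert_space"
  assumes "\<And>g. cinner u g = cinner v g"
  shows "u = v"
proof -
  have "cinner (u - v) (u - v) + cinner v (u - v) = cinner u (u - v)"
    by (simp flip: cinner_add_left)
  then have "cinner (u - v) (u - v) = 0"
    by (simp add: assms)
  then have "norm (u - v) = 0"
    by (simp add: norm_eq_sqrt_cinner)
  then show ?thesis by simp
qed

lemma bessel_multiplier_total_iff:
  "bessel_multiplier M m F G = (\<lambda>f. Some (T f)) \<longleftrightarrow>
     (\<forall>f g. integrable M (\<lambda>w. m w * cinner f (F w) * cinner (G w) g) \<and>
            cinner (T f) g = (\<integral>w. m w * cinner f (F w) * cinner (G w) g \<partial>M))"
proof -
  have uniq: "u = v" if "weak_multiplier_value M m F G f u" "weak_multiplier_value M m F G f v"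
    for f u v using that by (intro cinner_eqI) (simp add: weak_multiplier_value_def)
  have the: "(THE v. weak_multiplier_value M m F G f v) = v" if "weak_multiplier_value M m F G f v" for f v
    using that by (blast intro: the_equality uniq)
  have "bessel_multiplier M m F G f = Some v \<longleftrightarrow> weak_multiplier_value M m F G f v" for f v
  proof (cases "\<exists>u. weak_multiplier_value M m F G f u")
    case True
    then obtain u where u: "weak_multiplier_value M m F G f u" by blast
    then have "bessel_multiplier M m F G f = Some u"
      unfolding bessel_multiplier_def the[OF u] by auto
    with u show ?thesis using uniq by auto
  next
    case False
    then show ?thesis by (auto simp: bessel_multiplier_def)
  qed
  then show ?thesis
    unfolding fun_eq_iff by (simp add: weak_multiplier_value_def)
qed

lemma operator_dist_total:
  assumes "bounded_linear S" "bounded_linear T"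
  shows "operator_dist (\<lambda>f. Some (S f)) (\<lambda>f. Some (T f)) = ennreal (onorm (\<lambda>f. S f - T f))"
proof -
  let ?D = "\<lambda>f. S f - T f"
  have D: "bounded_linear ?D" using assms by (rule bounded_linear_sub)
  interpret D: bounded_linear ?D by (rule D)
  let ?s = "SUP f\<in>{f. norm f \<le> 1}. ennreal (norm (?D f))"
  have le: "?s \<le> ennreal (onorm ?D)"
  proof (rule SUP_least)
    fix f :: 'a assume "f \<in> {f. norm f \<le> 1}"
    then have "onorm ?D * norm f \<le> onorm ?D"
      using mult_left_mono[of "norm f" 1, OF _ onorm_pos_le[OF D]] by simp
    then show "ennreal (norm (?D f)) \<le> ennreal (onorm ?D)"
      using onorm[OF D, of f] by (intro ennreal_leI) linarith
  qed
  have s_fin: "?s < top" using le ennreal_less_top by (rule order_le_less_trans)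
  have "onorm ?D \<le> enn2real ?s"
  proof (rule onorm_bound)
    fix f :: 'a
    show "norm (?D f) \<le> enn2real ?s * norm f"
    proof (cases "f = 0")
      case False
      let ?u = "f /\<^sub>R norm f"
      have "ennreal (norm (?D ?u)) \<le> ?s"
        by (rule SUP_upper) (simp add: False)
      then have "norm (?D ?u) \<le> enn2real ?s"
        using enn2real_mono[OF _ s_fin, of "ennreal (norm (?D ?u))"]
        by (simp only: enn2real_ennreal[OF norm_ge_zero])
      moreover have "norm (?D ?u) = norm (?D f) / norm f"
        by (simp only: D.scaleR) (simp add: divide_inverse mult.commute)
      ultimately have "norm (?D f) / norm f \<le> enn2real ?s" by (simp only:)
      moreover have "0 < norm f" using False by simp
      ultimately show ?thesis using pos_divide_le_eq by blast
    qed (simp add: D.zero)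
  qed simp
  then have "ennreal (onorm ?D) \<le> ennreal (enn2real ?s)"
    by (rule ennreal_leI)
  then have "ennreal (onorm ?D) \<le> ?s"
    by (simp only: ennreal_enn2real[OF s_fin])
  with le have "?s = ennreal (onorm ?D)" by (rule antisym)
  then show ?thesis by (simp only: operator_dist_def dom_def) simp
qed

lemma converges_in_operator_norm_total_iff:
  assumes "\<And>n. bounded_linear (S n)" "bounded_linear T"
  shows "converges_in_operator_norm (\<lambda>n f. Some (S n f)) (\<lambda>f. Some (T f)) \<longleftrightarrow>
    (\<lambda>n. onorm (\<lambda>f. S n f - T f)) \<longlonglongrightarrow> 0"
proof -
  have "0 \<le> onorm (\<lambda>f. S n f - T f)" for n
    by (intro onorm_pos_le bounded_linear_sub assms)
  then show ?thesis
    unfolding converges_in_operator_norm_def operator_dist_total[OF assms]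
    using tendsto_ennreal_iff[of "\<lambda>n. onorm (\<lambda>f. S n f - T f)" sequentially 0]
    by (simp add: dom_def)
qed

end

theory Submission
  imports Defs
begin

text \<open>
  The weak form of \<open>M\<^sub>m\<^sub>,\<^sub>F'\<^sub>,\<^sub>G - M\<^sub>m\<^sub>,\<^sub>F\<^sub>,\<^sub>G\<close> at \<open>f\<close> is
  \<open>g \<mapsto> \<integral> m \<langle>f, F' - F\<rangle> \<langle>G, g\<rangle> d\<mu>\<close>. If \<open>\<parallel>F' - F\<parallel> \<le> \<epsilon>\<close> everywhere and \<open>\<parallel>G\<parallel> \<le> L\<close> almost
  everywhere, then by Cauchy--Schwarz the integrand is dominated by
  \<open>\<epsilon> L \<parallel>f\<parallel> \<parallel>g\<parallel> |m|\<close>. So the form converges for all \<open>f\<close> and \<open>g\<close>, even where the forms of the two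
  multipliers do not, and is bounded by \<open>\<epsilon> L \<parallel>m\<parallel>\<^sub>1 \<parallel>f\<parallel> \<parallel>g\<parallel>\<close>.

  As \<open>G\<close> is only weakly measurable and the space may be nonseparable, \<open>\<integral> m \<langle>f, F' - F\<rangle> G d\<mu>\<close>
  need not exist as a Bochner integral; the Riesz representation theorem
  (\<open>riesz_representation\<close>) supplies the vector \<open>d\<close> that represents the form. Adding or subtracting
  \<open>d\<close> turns a value of one multiplier at \<open>f\<close> into a value of the other. Hence the two partial
  operators have the same domain, and on its unit ball they differ by at most
  \<open>\<epsilon> L \<parallel>m\<parallel>\<^sub>1\<close> (\<open>bessel_multiplier_perturbation\<close>). Uniform convergence lets \<open>\<epsilon>\<close> tend to \<open>0\<close>.
\<close>

section \<open>Inner products\<close>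

lemma cinner_add_right: "cinner x (y + z) = cinner x y + cinner x z"
  by (metis cinner_add_left cinner_commute complex_cnj_add)

lemma cinner_scaleC_right: "cinner x (c *\<^sub>C y) = cnj c * cinner x y"
  by (metis cinner_commute cinner_scaleC_left complex_cnj_mult)

lemma cinner_diff_left: "cinner (x - y) z = cinner x z - cinner y z"
  by (metis add_diff_cancel_right' cinner_add_left diff_add_cancel)

lemma cinner_diff_right: "cinner x (y - z) = cinner x y - cinner x z"
  by (metis add_diff_cancel_right' cinner_add_right diff_add_cancel)

lemma cinner_scaleR_right: "cinner x (r *\<^sub>R y) = of_real r * cinner x y"
  by (simp add: scaleR_scaleC cinner_scaleC_right)

lemma Re_cinner_self: "Re (cinner x x) = (norm x)\<^sup>2"
  by (simp add: norm_eq_sqrt_cinner cinner_self_nonneg)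

lemma Re_cinner_commute: "Re (cinner x y) = Re (cinner y x)"
  by (metis cinner_commute cnj.sel(1))

lemma norm_add_sq: "(norm (x + y))\<^sup>2 = (norm x)\<^sup>2 + 2 * Re (cinner x y) + (norm y)\<^sup>2"
  using Re_cinner_commute[of x y]
  by (simp flip: Re_cinner_self add: cinner_add_left cinner_add_right)

lemma parallelogram_law:
  fixes x y :: "'a::complex_hilbert_space"
  shows "(norm (x - y))\<^sup>2 + (norm (x + y))\<^sup>2 = 2 * (norm x)\<^sup>2 + 2 * (norm y)\<^sup>2"
  by (simp flip: Re_cinner_self
      add: cinner_add_left cinner_add_right cinner_diff_left cinner_diff_right)

lemma norm_scaleC: "norm (c *\<^sub>C x) = cmod c * norm x"
proof -
  have "cnj c * c = complex_of_real ((cmod c)\<^sup>2)"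
    by (metis complex_norm_square mult.commute)
  then have "cinner (c *\<^sub>C x) (c *\<^sub>C x) = of_real ((cmod c)\<^sup>2) * cinner x x"
    by (simp only: cinner_scaleC_left cinner_scaleC_right flip: mult.assoc)
  then have "(norm (c *\<^sub>C x))\<^sup>2 = (cmod c * norm x)\<^sup>2"
    by (simp flip: Re_cinner_self add: power_mult_distrib)
  then show ?thesis
    by (simp add: power2_eq_iff_nonneg)
qed

text \<open>The triangle inequality, squared, gives the bound for the real part; a rotation of \<open>x\<close> makes
  the inner product real and nonnegative.\<close>

lemma cinner_Cauchy_Schwarz: "cmod (cinner x y) \<le> norm x * norm y"
proof (cases "cinner x y = 0")
  case False
  have re: "Re (cinner z y) \<le> norm z * norm y" for z
    using power_mono[OF norm_triangle_ineq[of z y] norm_ge_zero, of 2]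
    by (simp add: norm_add_sq power2_sum)
  define u where "u = cnj (cinner x y) / of_real (cmod (cinner x y))"
  have "cnj (cinner x y) * cinner x y = of_real (cmod (cinner x y)) * of_real (cmod (cinner x y))"
    by (metis complex_norm_square mult.commute of_real_mult power2_eq_square)
  then have "cinner (u *\<^sub>C x) y = of_real (cmod (cinner x y))"
    using False by (simp add: cinner_scaleC_left u_def)
  moreover have "norm (u *\<^sub>C x) = norm x"
    using False by (simp add: norm_scaleC u_def norm_divide)
  ultimately show ?thesis
    using re[of "u *\<^sub>C x"] by simp
qed simp

section \<open>The Riesz representation theorem\<close>

text \<open>The representing vector minimises \<open>J v = \<parallel>v\<parallel>\<^sup>2 - 2 L v\<close>: by the parallelogram law minimising
  sequences are Cauchy, and the derivative of \<open>J\<close> at a minimiser vanishes in every direction.\<close>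

lemma riesz_representation_real:
  fixes L :: "'a::complex_hilbert_space \<Rightarrow> real"
  assumes "bounded_linear L"
  obtains v where "\<And>g. Re (cinner v g) = L g"
proof -
  interpret L: bounded_linear L by fact
  define J where "J v = (norm v)\<^sup>2 - 2 * L v" for v
  obtain K where K: "\<And>v. norm (L v) \<le> norm v * K"
    using L.bounded by blast
  have "- K\<^sup>2 \<le> J v" for v
  proof -
    have "L v \<le> norm v * K"
      using K[of v] by simp
    then show ?thesis
      using zero_le_power2[of "norm v - K"] by (simp add: J_def power2_diff)
  qed
  then have bdd: "bdd_below (range J)" by (auto intro!: bdd_belowI[where m = "- K\<^sup>2"])
  define d where "d = Inf (range J)"
  have d_le: "d \<le> J v" for v
    unfolding d_def using bdd by (intro cInf_lower) auto
  have "\<exists>v. J v < d + inverse (real (Suc n))" for n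
    using cInf_lessD[of "range J" "d + inverse (real (Suc n))"] unfolding d_def by auto
  then obtain s where s: "\<And>n. J (s n) < d + inverse (real (Suc n))" by metis
  have par: "(norm (x - y))\<^sup>2 \<le> 2 * (J x - d) + 2 * (J y - d)" for x y
  proof -
    have "4 * J ((1/2) *\<^sub>R (x + y)) = (norm (x + y))\<^sup>2 - 4 * L x - 4 * L y"
      unfolding J_def L.scaleR L.add norm_scaleR
      by (simp add: power_mult_distrib power_divide right_diff_distrib add_divide_distrib)
    then show ?thesis
      using d_le[of "(1/2) *\<^sub>R (x + y)"] parallelogram_law[of x y] by (simp add: J_def)
  qed
  have "Cauchy s"
  proof (rule CauchyI)
    fix e :: real assume "0 < e"
    then obtain N where N: "inverse (real (Suc N)) < e\<^sup>2 / 4"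
      using reals_Archimedean[of "e\<^sup>2 / 4"] by auto
    have close: "J (s n) - d < e\<^sup>2 / 4" if "n \<ge> N" for n
    proof -
      have "inverse (real (Suc n)) \<le> inverse (real (Suc N))"
        using that by (intro le_imp_inverse_le) auto
      then show ?thesis
        using s[of n] N by linarith
    qed
    have "norm (s i - s j) < e" if "i \<ge> N" "j \<ge> N" for i j
    proof -
      have "(norm (s i - s j))\<^sup>2 < e\<^sup>2"
        using par[of "s i" "s j"] close[OF that(1)] close[OF that(2)] by argo
      then show ?thesis
        using \<open>0 < e\<close> by (simp add: power_less_imp_less_base)
    qed
    then show "\<exists>N. \<forall>i\<ge>N. \<forall>j\<ge>N. norm (s i - s j) < e" by blast
  qed
  then obtain v where v: "s \<longlonglongrightarrow> v"
    using Cauchy_convergent convergent_def by blast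
  have "(\<lambda>n. J (s n)) \<longlonglongrightarrow> J v"
    unfolding J_def by (intro tendsto_intros L.tendsto v)
  moreover have "(\<lambda>n. d + inverse (real (Suc n))) \<longlonglongrightarrow> d + 0"
    by (intro tendsto_intros LIMSEQ_inverse_real_of_nat)
  ultimately have "J v \<le> d + 0"
    using s by (intro LIMSEQ_le) (auto intro: less_imp_le)
  then have min: "J v \<le> J w" for w
    using d_le[of w] by linarith
  have "Re (cinner v g) = L g" for g
  proof -
    define a where "a = Re (cinner v g) - L g"
    define t where "t = - a / (1 + (norm g)\<^sup>2)"
    have pos: "0 < 1 + (norm g)\<^sup>2"
      by (simp add: add_pos_nonneg)
    have "J (v + t *\<^sub>R g) = J v + 2 * t * a + t\<^sup>2 * (norm g)\<^sup>2"
      unfolding J_def norm_add_sq L.add L.scaleR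
      by (simp add: cinner_scaleR_right a_def power_mult_distrib algebra_simps)
    then have "0 \<le> 2 * t * a + t\<^sup>2 * (norm g)\<^sup>2"
      using min[of "v + t *\<^sub>R g"] by linarith
    \<comment> \<open>This \<open>t\<close> approximates the minimiser of the quadratic in \<open>t\<close>; the added \<open>1\<close> avoids division
      by zero and still leaves a negative value unless \<open>a = 0\<close>.\<close>
    moreover have "t * (1 + (norm g)\<^sup>2) = - a"
      using pos by (simp add: t_def)
    then have "2 * t * a + t\<^sup>2 * (norm g)\<^sup>2 = - t\<^sup>2 * (2 + (norm g)\<^sup>2)"
      by algebra
    ultimately have "t\<^sup>2 * (2 + (norm g)\<^sup>2) \<le> 0"
      by linarith
    then have "t = 0"
      by (smt (verit) mult_pos_pos zero_le_power2 zero_less_power2)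
    then show ?thesis
      using pos by (simp add: t_def a_def)
  qed
  then show ?thesis using that by blast
qed

text \<open>A conjugate linear form is determined by its real part, because
  \<open>Im (\<phi> g) = Re (\<phi> (\<i> g))\<close>.\<close>

lemma riesz_representation:
  fixes \<phi> :: "'a::complex_hilbert_space \<Rightarrow> complex"
  assumes add: "\<And>g h. \<phi> (g + h) = \<phi> g + \<phi> h"
    and scale: "\<And>c g. \<phi> (c *\<^sub>C g) = cnj c * \<phi> g"
    and bound: "\<And>g. cmod (\<phi> g) \<le> K * norm g" and "0 \<le> K"
  obtains v where "\<And>g. cinner v g = \<phi> g" and "norm v \<le> K"
proof -
  have "bounded_linear (\<lambda>g. Re (\<phi> g))"
  proof (rule bounded_linear_intro[where K = K])
    show "norm (Re (\<phi> g)) \<le> norm g * K" for g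
      using bound[of g] abs_Re_le_cmod[of "\<phi> g"] by (simp add: mult.commute)
  qed (simp_all add: add scale scaleR_scaleC)
  then obtain v where v: "\<And>g. Re (cinner v g) = Re (\<phi> g)"
    by (rule riesz_representation_real) blast
  have eq: "cinner v g = \<phi> g" for g
    using v[of g] v[of "\<i> *\<^sub>C g"] by (simp add: cinner_scaleC_right scale complex_eq_iff)
  have "norm v * norm v \<le> K * norm v"
    using bound[of v] complex_Re_le_cmod[of "\<phi> v"] Re_cinner_self[of v]
    by (simp add: eq power2_eq_square)
  then have "norm v \<le> K"
    using \<open>0 \<le> K\<close> by (cases "v = 0") (auto simp: mult_le_cancel_right)
  with eq show ?thesis using that by blast
qed

section \<open>Perturbing the first mapping of a multiplier\<close>

lemma bessel_multiplier_eq_Some_iff: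
  "bessel_multiplier M m F G f = Some v \<longleftrightarrow> weak_multiplier_value M m F G f v"
proof -
  have "u = v" if "weak_multiplier_value M m F G f u" "weak_multiplier_value M m F G f v" for u v
    using that by (intro cinner_eqI) (simp add: weak_multiplier_value_def)
  then have "(THE v. weak_multiplier_value M m F G f v) = v" if "weak_multiplier_value M m F G f v" for v
    using that by (blast intro: the_equality)
  then show ?thesis
    by (auto simp: bessel_multiplier_def)
qed

lemma weak_multiplier_value_add:
  assumes "weak_multiplier_value M m F G f u" "weak_multiplier_value M m H G f v"
  shows "weak_multiplier_value M m (\<lambda>w. F w + H w) G f (u + v)"
  using assms
  by (simp add: weak_multiplier_value_def cinner_add_left cinner_add_right algebra_simps)

lemma weak_multiplier_value_diff:
  assumes "weak_multiplier_value M m F G f u" "weak_multiplier_value M m H G f v"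
  shows "weak_multiplier_value M m (\<lambda>w. F w - H w) G f (u - v)"
  using assms
  by (simp add: weak_multiplier_value_def cinner_diff_left cinner_diff_right algebra_simps)

text \<open>With \<open>D\<close> the difference of two mappings in the first place, \<open>d\<close> is the difference of the two
  multipliers at \<open>f\<close>. It exists by the Riesz representation of the form
  \<open>g \<mapsto> \<integral> m \<langle>f, D\<rangle> \<langle>G, g\<rangle> d\<mu>\<close>, whose integrand is dominated by a multiple of \<open>|m|\<close>.\<close>

lemma weak_multiplier_value_of_bounded:
  fixes D G :: "'w \<Rightarrow> 'a::complex_hilbert_space"
  assumes m: "integrable M m"
    and D: "(\<lambda>w. cinner f (D w)) \<in> borel_measurable M"
    and G: "\<And>g. (\<lambda>w. cinner g (G w)) \<in> borel_measurable M"
    and D_le: "\<And>w. w \<in> space M \<Longrightarrow> norm (D w) \<le> \<epsilon>"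
    and G_le: "AE w in M. norm (G w) \<le> L"
    and nonneg: "0 \<le> \<epsilon>" "0 \<le> L"
  obtains d where "weak_multiplier_value M m D G f d"
    and "norm d \<le> \<epsilon> * L * (\<integral>w. cmod (m w) \<partial>M) * norm f"
proof -
  let ?h = "\<lambda>g w. m w * cinner f (D w) * cinner (G w) g"
  let ?b = "\<lambda>g w. \<epsilon> * L * norm f * norm g * cmod (m w)"
  have meas: "?h g \<in> borel_measurable M" for g
  proof -
    have "(\<lambda>w. cnj (cinner g (G w))) \<in> borel_measurable M"
      using G by (intro borel_measurable_continuous_on[where f = cnj] continuous_intros)
    then have "(\<lambda>w. cinner (G w) g) \<in> borel_measurable M"
      by (simp flip: cinner_commute)
    with borel_measurable_integrable[OF m] D show ?thesis by measurable
  qed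
  have le: "AE w in M. norm (?h g w) \<le> ?b g w" for g
    using G_le AE_space
  proof eventually_elim
    case (elim w)
    have "cmod (cinner f (D w)) \<le> norm f * \<epsilon>"
      using cinner_Cauchy_Schwarz[of f "D w"] D_le[OF elim(2)]
      by (meson mult_left_mono norm_ge_zero order_trans)
    moreover have "cmod (cinner (G w) g) \<le> L * norm g"
      using cinner_Cauchy_Schwarz[of "G w" g] elim(1)
      by (meson mult_right_mono norm_ge_zero order_trans)
    ultimately have "cmod (cinner f (D w)) * cmod (cinner (G w) g) \<le> (norm f * \<epsilon>) * (L * norm g)"
      using nonneg by (intro mult_mono) auto
    then have "cmod (m w) * (cmod (cinner f (D w)) * cmod (cinner (G w) g))
        \<le> cmod (m w) * ((norm f * \<epsilon>) * (L * norm g))"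
      by (rule mult_left_mono) simp
    then show ?case
      by (simp add: norm_mult mult_ac)
  qed
  have int_b: "integrable M (?b g)" for g
    using m by simp
  have int: "integrable M (?h g)" for g
    by (rule Bochner_Integration.integrable_bound[OF int_b[of g] meas])
      (use le[of g] in \<open>auto elim!: eventually_mono\<close>)
  define \<phi> where "\<phi> g = (\<integral>w. ?h g w \<partial>M)" for g
  have "cmod (\<phi> g) \<le> (\<epsilon> * L * (\<integral>w. cmod (m w) \<partial>M) * norm f) * norm g" for g
  proof -
    have "cmod (\<phi> g) \<le> (\<integral>w. norm (?h g w) \<partial>M)"
      unfolding \<phi>_def by (rule integral_norm_bound)
    also have "\<dots> \<le> (\<integral>w. ?b g w \<partial>M)"
      by (rule integral_mono_AE[OF integrable_norm[OF int] int_b le])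
    also have "\<dots> = (\<epsilon> * L * (\<integral>w. cmod (m w) \<partial>M) * norm f) * norm g"
      by simp
    finally show ?thesis .
  qed
  moreover have "\<phi> (g + h) = \<phi> g + \<phi> h" for g h
    unfolding \<phi>_def using int[of g] int[of h]
    by (simp add: cinner_add_right distrib_left flip: Bochner_Integration.integral_add)
  moreover have "\<phi> (c *\<^sub>C g) = cnj c * \<phi> g" for c g
  proof -
    have "?h (c *\<^sub>C g) = (\<lambda>w. cnj c * ?h g w)"
      by (simp add: cinner_scaleC_right mult_ac)
    then show ?thesis
      unfolding \<phi>_def by (simp only: integral_mult_right_zero)
  qed
  moreover have "0 \<le> \<epsilon> * L * (\<integral>w. cmod (m w) \<partial>M) * norm f"
    using nonneg by simp
  ultimately obtain d where "\<And>g. cinner d g = \<phi> g"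
    and "norm d \<le> \<epsilon> * L * (\<integral>w. cmod (m w) \<partial>M) * norm f"
    using riesz_representation[of \<phi>] by blast
  with int show ?thesis
    using that[of d] by (simp add: weak_multiplier_value_def \<phi>_def)
qed

text \<open>The difference \<open>F' - F\<close> has a multiplier value at every \<open>f\<close>, so \<open>F'\<close> and \<open>F\<close> have values at
  the same \<open>f\<close>.\<close>

lemma bessel_multiplier_perturbation:
  fixes F F' G :: "'w \<Rightarrow> 'a::complex_hilbert_space"
  assumes m: "integrable M m"
    and F: "\<And>f. (\<lambda>w. cinner f (F w)) \<in> borel_measurable M"
    and F': "\<And>f. (\<lambda>w. cinner f (F' w)) \<in> borel_measurable M"
    and G: "\<And>f. (\<lambda>w. cinner f (G w)) \<in> borel_measurable M"
    and close: "\<And>w. w \<in> space M \<Longrightarrow> norm (F' w - F w) \<le> \<epsilon>"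
    and G_le: "AE w in M. norm (G w) \<le> L"
    and nonneg: "0 \<le> \<epsilon>" "0 \<le> L"
  shows "dom (bessel_multiplier M m F' G) = dom (bessel_multiplier M m F G)"
    and "operator_dist (bessel_multiplier M m F' G) (bessel_multiplier M m F G)
      \<le> ennreal (\<epsilon> * L * (\<integral>w. cmod (m w) \<partial>M))"
proof -
  let ?W = "weak_multiplier_value M m"
  let ?C = "\<epsilon> * L * (\<integral>w. cmod (m w) \<partial>M)"
  have "\<exists>d. ?W (\<lambda>w. F' w - F w) G f d \<and> norm d \<le> ?C * norm f" for f
  proof -
    have "(\<lambda>w. cinner f (F' w - F w)) \<in> borel_measurable M"
      using F F' by (simp add: cinner_diff_right)
    from weak_multiplier_value_of_bounded[OF m this G close G_le nonneg]
    show ?thesis by blast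
  qed
  then obtain d where d: "\<And>f. ?W (\<lambda>w. F' w - F w) G f (d f)"
    and d_le: "\<And>f. norm (d f) \<le> ?C * norm f"
    by metis
  have to: "?W F' G f (u + d f)" if "?W F G f u" for f u
    using weak_multiplier_value_add[OF that d] by simp
  have from': "?W F G f (u - d f)" if "?W F' G f u" for f u
    using weak_multiplier_value_diff[OF that d] by simp
  show dom: "dom (bessel_multiplier M m F' G) = dom (bessel_multiplier M m F G)"
    by (auto simp: dom_def bessel_multiplier_eq_Some_iff intro: to from')
  show "operator_dist (bessel_multiplier M m F' G) (bessel_multiplier M m F G) \<le> ennreal ?C"
    unfolding operator_dist_def
  proof (rule SUP_least)
    fix f
    assume f: "f \<in> {f \<in> dom (bessel_multiplier M m F' G) \<inter> dom (bessel_multiplier M m F G).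
      norm f \<le> 1}"
    then obtain u where u: "bessel_multiplier M m F G f = Some u" by blast
    then have "bessel_multiplier M m F' G f = Some (u + d f)"
      using to by (simp add: bessel_multiplier_eq_Some_iff)
    moreover have "?C * norm f \<le> ?C"
      using f nonneg by (intro mult_right_le_one_le) auto
    ultimately show "ennreal (norm (the (bessel_multiplier M m F' G f)
        - the (bessel_multiplier M m F G f))) \<le> ennreal ?C"
      using u d_le[of f] by (intro ennreal_leI) simp
  qed
qed

section \<open>Convergence of multipliers\<close>

theorem theorem3p14:
  fixes M :: "'w measure" and m :: "'w \<Rightarrow> complex"
    and F G :: "'w \<Rightarrow> 'a::complex_hilbert_space"
    and Fn :: "nat \<Rightarrow> 'w \<Rightarrow> 'a"
  assumes "integrable M m"
    and "bessel_mapping M F"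
    and "bessel_mapping M G"
    and "norm_bounded_mapping M G"
    and "\<And>n. bessel_mapping M (Fn n)"
    and "\<forall>\<epsilon>>0. \<exists>N. \<forall>n\<ge>N. \<forall>w\<in>space M. norm (Fn n w - F w) \<le> \<epsilon>"
  shows "converges_in_operator_norm
           (\<lambda>n. bessel_multiplier M m (Fn n) G) (bessel_multiplier M m F G)"
proof -
  obtain L0 where "AE w in M. norm (G w) \<le> L0"
    using assms(4) unfolding norm_bounded_mapping_def by blast
  \<comment> \<open>On a null space \<open>L0\<close> may be negative.\<close>
  define L where "L = max L0 0"
  have L: "AE w in M. norm (G w) \<le> L" "0 \<le> L"
    using \<open>AE w in M. norm (G w) \<le> L0\<close> unfolding L_def by (auto elim: eventually_mono)
  let ?T = "bessel_multiplier M m F G" and ?S = "\<lambda>n. bessel_multiplier M m (Fn n) G"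
  define C where "C = L * (\<integral>w. cmod (m w) \<partial>M)"
  have "0 \<le> C"
    using L(2) by (simp add: C_def)
  have close: "\<forall>\<^sub>F n in sequentially. dom (?S n) = dom ?T \<and> operator_dist (?S n) ?T \<le> ennreal (\<epsilon> * C)"
    if "0 < \<epsilon>" for \<epsilon>
  proof -
    obtain N where N: "\<And>n w. n \<ge> N \<Longrightarrow> w \<in> space M \<Longrightarrow> norm (Fn n w - F w) \<le> \<epsilon>"
      using assms(6) \<open>0 < \<epsilon>\<close> by meson
    have "dom (?S n) = dom ?T \<and> operator_dist (?S n) ?T \<le> ennreal (\<epsilon> * C)" if "n \<ge> N" for n
      using bessel_multiplier_perturbation[OF assms(1) _ _ _ N[OF that] L(1) less_imp_le[OF \<open>0 < \<epsilon>\<close>] L(2)]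
        assms(2,3) assms(5)[of n]
      by (simp add: bessel_mapping_def C_def mult.assoc)
    then show ?thesis
      by (auto simp: eventually_sequentially)
  qed
  have "(\<lambda>n. operator_dist (?S n) ?T) \<longlonglongrightarrow> 0"
  proof (rule order_tendstoI)
    fix a :: ennreal assume "0 < a"
    then obtain b where b: "0 < b" "b < a"
      using dense by blast
    then obtain e where e: "b = ennreal e" "0 < e"
      by (cases b) auto
    have "e / (C + 1) * C \<le> e"
      using \<open>0 \<le> C\<close> e by (simp add: field_simps)
    then have "ennreal (e / (C + 1) * C) < a"
      using b e by (meson ennreal_leI order_le_less_trans)
    moreover have "0 < e / (C + 1)"
      using \<open>0 \<le> C\<close> e by simp
    ultimately show "\<forall>\<^sub>F n in sequentially. operator_dist (?S n) ?T < a"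
      using close[of "e / (C + 1)"] by (auto elim: eventually_mono)
  qed simp
  then show ?thesis
    using close[of 1] by (auto simp: converges_in_operator_norm_def elim: eventually_mono)
qed

end
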